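(* Assume (A1)–(A4) below. Then the problem $$\min_{p\in\mathcal M(c)} D_G(p\,\|\,p_0)$$ has a solution $p^*$, unique up to $\mu$-a.e. equality, and it has the form $$p^*(\xi)=F'\big(G'(p_0(\xi))+\langle\lambda,T(\xi)\rangle\big)\quad\text{for }\mu\text{-a.e. }\xi,$$ where $\lambda\in\mathcal D$ solves $\mathbb E_{p^*}[T]=c$ and is unique modulo $\mathcal N$ (any two such $\lambda$ differ by an element of $\mathcal N$). In particular $p^*$ belongs to the $G$-exponential family $\mathcal E_G(p_0,T)$. Moreover, for every $p\in\mathcal M(c)$ the Pythagorean identity holds: $$D_G(p\,\|\,p_0)=D_G(p\,\|\,p^* )+D_G(p^*\,\|\,p_0).$$
   Context: Let $(\Xi,\mathcal A,\mu)$ be a $\sigma$-finite measure space, $I\subseteq\mathbb R$ an open interval, $G:I\to\mathbb R$, $T:\Xi\to\mathbb R^k$ measurable, $c\in\mathbb R^k$, and $p_0:\Xi\to I$ measurable. Put $d_G(s,t)=G(s)-G(t)-G'(t)(s-t)$ for $s,t\in I$, and for measurable $p,q:\Xi\to I$, $D_G(p\|q)=\int_\Xi d_G(p(\xi),q(\xi))\,d\mu(\xi)\in[0,\infty]$. Write $\mathbb E_p[T]=\int_\Xi p\,T\,d\mu$ (requiring $pT$ to be $\mu$-integrable). Let $I^*=G'(I)$ and let $F(u)=\sup_{s\in I}\{us-G(s)\}$, $u\in I^*$, be the convex conjugate, so that $F'=(G')^{-1}$ on $I^*$. The $G$-exponential family through $p_0$ is $\mathcal E_G(p_0,T)=\{F'(G'(p_0)+\langle\lambda,T\rangle):\lambda\in\mathbb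 R^k,\ G'(p_0)+\langle\lambda,T\rangle\in I^*\ \mu\text{-a.e.}\}$. Let $\mathcal N=\{a\in\mathbb R^k:\langle a,T\rangle=0\ \mu\text{-a.e.}\}$, $\mathcal D=\{\lambda\in\mathbb R^k: G'(p_0)+\langle\lambda,T\rangle\in I^*\ \mu\text{-a.e.},\ \int_\Xi F(G'(p_0)+\langle\lambda,T\rangle)\,d\mu<\infty\}$, and for $\lambda\in\mathcal D$ let $p^*_\lambda=F'(G'(p_0)+\langle\lambda,T\rangle)$ and $\Phi(\lambda)=\langle\lambda,c\rangle-\int_\Xi F(G'(p_0)+\langle\lambda,T\rangle)\,d\mu+C_0$, $C_0=\int_\Xi F(G'(p_0))\,d\mu$; set $\Phi=-\infty$ outside $\mathcal D$. Assumptions: (A1) $G\in C^2(I)$ is strictly convex with $G''>0$ on $I$. (A2) The feasible set $\mathcal M(c)=\{p:\Xi\to I \text{ measurable}:\mathbb E_p[T]=c,\ D_G(p\|p_0)<\infty\}$ is nonempty. (A3) $\Phi$ attains its supremum at some point $\lambda^*\in\operatorname{ri}(\mathcal D)$ (relative interior; $\lambda^*$ being considered modulo $\mathcal N$); in addition $0\in\mathcal D$, and $F(G'(p_0))$ is $\mu$-integrable, so $C_0$ is finite. (A4) Differentiation under the integral sign is valid on $\operatorname{ri}(\mathcal D)$: for every $\lambda\in\operatorname{ri}(\mathcal D)$, $p^*_\lambda T$ is integrable and $\Phi$ (as a function on $\mathbb R^k$) is differentiable at $\lambda$ with gradient $\nabla\Phi(\lambda)=c-\mathbb E_{p^*_\lambda}[T]$.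 *)

theory Defs
  imports "HOL-Analysis.Analysis"
begin

text \<open>
  Throughout, \<open>I\<close> is the open interval on which the generator \<open>G\<close> lives; \<open>G\<close> is a total function,
  but only its values on \<open>I\<close> matter. Measurable maps into \<open>I\<close> are elements of
  \<open>M \<rightarrow>\<^sub>M restrict_space borel I\<close>.
\<close>

definition strict_convex_on :: "real set \<Rightarrow> (real \<Rightarrow> real) \<Rightarrow> bool" where
  "strict_convex_on S f \<longleftrightarrow> convex S \<and>
     (\<forall>x\<in>S. \<forall>y\<in>S. \<forall>t. x \<noteq> y \<longrightarrow> 0 < t \<longrightarrow> t < 1 \<longrightarrow>
        f ((1 - t) * x + t * y) < (1 - t) * f x + t * f y)"

definition bregman :: "(real \<Rightarrow> real) \<Rightarrow> real \<Rightarrow> real \<Rightarrow> real" where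
  "bregman G s t = G s - G t - deriv G t * (s - t)"

text \<open>For convex \<open>G\<close> the integrand is nonnegative, so nothing is lost in passing to \<open>ennreal\<close>.\<close>

definition bregman_div ::
  "'a measure \<Rightarrow> (real \<Rightarrow> real) \<Rightarrow> ('a \<Rightarrow> real) \<Rightarrow> ('a \<Rightarrow> real) \<Rightarrow> ennreal" where
  "bregman_div M G p q = (\<integral>\<^sup>+x. ennreal (bregman G (p x) (q x)) \<partial>M)"

definition dual_interval :: "(real \<Rightarrow> real) \<Rightarrow> real set \<Rightarrow> real set" where
  "dual_interval G I = deriv G ` I"

text \<open>Meaningful on \<^term>\<open>dual_interval G I\<close>, where the supremum is finite.\<close>

definition conv_conj :: "(real \<Rightarrow> real) \<Rightarrow> real set \<Rightarrow> real \<Rightarrow> real" where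
  "conv_conj G I u = (SUP s\<in>I. u * s - G s)"

definition feasible ::
  "'a measure \<Rightarrow> (real \<Rightarrow> real) \<Rightarrow> real set \<Rightarrow> ('a \<Rightarrow> real^'k) \<Rightarrow> ('a \<Rightarrow> real) \<Rightarrow> real^'k
    \<Rightarrow> ('a \<Rightarrow> real) set" where
  "feasible M G I T p0 c =
     {p. p \<in> M \<rightarrow>\<^sub>M restrict_space borel I \<and>
         has_bochner_integral M (\<lambda>x. p x *\<^sub>R T x) c \<and>
         bregman_div M G p p0 < \<infinity>}"

definition dual_arg ::
  "(real \<Rightarrow> real) \<Rightarrow> ('a \<Rightarrow> real^'k) \<Rightarrow> ('a \<Rightarrow> real) \<Rightarrow> real^'k \<Rightarrow> 'a \<Rightarrow> real" where
  "dual_arg G T p0 l x = deriv G (p0 x) + l \<bullet> T x"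

text \<open>Members are determined up to null sets, since the defining formula makes sense only
  where the dual argument lies in \<^term>\<open>dual_interval G I\<close>.\<close>

definition G_exp_family ::
  "'a measure \<Rightarrow> (real \<Rightarrow> real) \<Rightarrow> real set \<Rightarrow> ('a \<Rightarrow> real^'k) \<Rightarrow> ('a \<Rightarrow> real)
    \<Rightarrow> ('a \<Rightarrow> real) set" where
  "G_exp_family M G I T p0 =
     {p. p \<in> M \<rightarrow>\<^sub>M restrict_space borel I \<and>
         (\<exists>l. (AE x in M. dual_arg G T p0 l x \<in> dual_interval G I) \<and>
              (AE x in M. p x = deriv (conv_conj G I) (dual_arg G T p0 l x)))}"

definition null_directions :: "'a measure \<Rightarrow> ('a \<Rightarrow> real^'k) \<Rightarrow> (real^'k) set" where
  "null_directions M T = {a. AE x in M. a \<bullet> T x = 0}"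

text \<open>
  Extended integral of a real function. As \<open>\<infinity> - \<infinity> = \<infinity>\<close> in \<open>ereal\<close>, it is \<open>< \<infinity>\<close> exactly
  when the positive part has finite integral, and then it is the usual value in \<open>[-\<infinity>, \<infinity>)\<close>.
\<close>

definition ext_integral :: "'a measure \<Rightarrow> ('a \<Rightarrow> real) \<Rightarrow> ereal" where
  "ext_integral M f =
     enn2ereal (\<integral>\<^sup>+x. ennreal (f x) \<partial>M) - enn2ereal (\<integral>\<^sup>+x. ennreal (- f x) \<partial>M)"

definition dual_domain ::
  "'a measure \<Rightarrow> (real \<Rightarrow> real) \<Rightarrow> real set \<Rightarrow> ('a \<Rightarrow> real^'k) \<Rightarrow> ('a \<Rightarrow> real)
    \<Rightarrow> (real^'k) set" where
  "dual_domain M G I T p0 =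
     {l. (AE x in M. dual_arg G T p0 l x \<in> dual_interval G I) \<and>
         ext_integral M (\<lambda>x. conv_conj G I (dual_arg G T p0 l x)) < \<infinity>}"

text \<open>For \<open>l\<close> in the dual domain the second branch is taken on a null set only; it fixes a
  representative with values in \<open>I\<close>.\<close>

definition p_star ::
  "(real \<Rightarrow> real) \<Rightarrow> real set \<Rightarrow> ('a \<Rightarrow> real^'k) \<Rightarrow> ('a \<Rightarrow> real) \<Rightarrow> real^'k \<Rightarrow> 'a \<Rightarrow> real" where
  "p_star G I T p0 l x =
     (if dual_arg G T p0 l x \<in> dual_interval G I
      then deriv (conv_conj G I) (dual_arg G T p0 l x) else p0 x)"

definition dual_objective ::
  "'a measure \<Rightarrow> (real \<Rightarrow> real) \<Rightarrow> real set \<Rightarrow> ('a \<Rightarrow> real^'k) \<Rightarrow> ('a \<Rightarrow> real) \<Rightarrow> real^'k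
    \<Rightarrow> real^'k \<Rightarrow> ereal" where
  "dual_objective M G I T p0 c l =
     (if l \<in> dual_domain M G I T p0
      then ereal (l \<bullet> c) - ext_integral M (\<lambda>x. conv_conj G I (dual_arg G T p0 l x))
           + ereal (LINT x|M. conv_conj G I (deriv G (p0 x)))
      else - \<infinity>)"

text \<open>An extended-real function is differentiable at a point if it is finite near that point and
  its real-valued version is differentiable there.\<close>

definition has_gradient_at ::
  "('b::real_inner \<Rightarrow> ereal) \<Rightarrow> 'b \<Rightarrow> 'b \<Rightarrow> bool" where
  "has_gradient_at f D l \<longleftrightarrow>
     (\<forall>\<^sub>F m in nhds l. \<bar>f m\<bar> \<noteq> \<infinity>) \<and> GDERIV (\<lambda>m. real_of_ereal (f m)) l :> D"

end

theory Submission
  imports Defs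
begin

text \<open>
  A maximizer \<open>l\<close> of the dual objective has vanishing gradient, which by (A4) says that
  \<open>p_star l\<close> satisfies the moment constraint. The three-point identity
  \<open>d(p, p0) = d(p, q) + d(q, p0) + (p - q) (G' q - G' p0)\<close> with \<open>q = p_star l\<close> has last term
  \<open>l \<bullet> (p - q) T\<close>, which integrates to zero for feasible \<open>p\<close>. This is the Pythagorean identity;
  minimality, finiteness of the divergence of \<open>q\<close> and uniqueness follow from it. For two
  parameters with the same moments, \<open>(p - p') (G' p - G' p')\<close> is nonnegative with integral
  zero, so \<open>p = p'\<close> and the dual arguments agree almost everywhere.
\<close>

section \<open>Monotonicity of G' and positivity of the Bregman distance\<close>

locale bregman_generator =
  fixes G :: "real \<Rightarrow> real" and I :: "real set"
  assumes open_I: "open I" and interval_I: "is_interval I"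
    and G_differentiable: "G differentiable_on I"
    and deriv_G_differentiable: "deriv G differentiable_on I"
    and deriv2_G_pos: "\<And>s. s \<in> I \<Longrightarrow> deriv (deriv G) s > 0"
begin

lemma DERIV_G: "s \<in> I \<Longrightarrow> (G has_real_derivative deriv G s) (at s)"
  using G_differentiable open_I
  by (simp add: differentiable_on_eq_differentiable_at DERIV_deriv_iff_real_differentiable)

lemma DERIV_deriv_G: "s \<in> I \<Longrightarrow> (deriv G has_real_derivative deriv (deriv G) s) (at s)"
  using deriv_G_differentiable open_I
  by (simp add: differentiable_on_eq_differentiable_at DERIV_deriv_iff_real_differentiable)

lemma continuous_on_G: "continuous_on I G"
  by (rule differentiable_imp_continuous_on[OF G_differentiable])

lemma continuous_on_deriv_G: "continuous_on I (deriv G)"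
  by (rule differentiable_imp_continuous_on[OF deriv_G_differentiable])

lemma deriv_G_less: "deriv G a < deriv G b" if "a \<in> I" "b \<in> I" "a < b"
proof (rule DERIV_pos_imp_increasing[OF \<open>a < b\<close>])
  fix x assume "a \<le> x" "x \<le> b"
  then have "x \<in> I" using that interval_I mem_is_interval_1_I by blast
  then show "\<exists>y. DERIV (deriv G) x :> y \<and> 0 < y"
    using DERIV_deriv_G deriv2_G_pos by blast
qed

lemma inj_on_deriv_G: "inj_on (deriv G) I"
  by (metis deriv_G_less inj_onI less_irrefl linorder_neqE)

lemma deriv_G_monotone_pos: "0 < (a - b) * (deriv G a - deriv G b)" if "a \<in> I" "b \<in> I" "a \<noteq> b"
  using that deriv_G_less[of a b] deriv_G_less[of b a]
  by (cases "a < b") (auto intro: mult_pos_pos mult_neg_neg)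

text \<open>By the mean value theorem \<open>bregman G s t\<close> equals
  \<open>(s - t) * (deriv G z - deriv G t)\<close> with \<open>z\<close> strictly between
  \<open>s\<close> and \<open>t\<close>. Since \<open>deriv G\<close> increases, both factors have
  the same sign. Working with \<open>min s t\<close> and \<open>max s t\<close> covers both orders
  with one application.\<close>

lemma bregman_pos: "0 < bregman G s t" if "s \<in> I" "t \<in> I" "s \<noteq> t"
proof -
  have mem: "x \<in> I" if "min s t \<le> x" "x \<le> max s t" for x
    using that \<open>s \<in> I\<close> \<open>t \<in> I\<close> interval_I mem_is_interval_1_I[of I "min s t" "max s t" x]
    by (auto simp: min_def max_def split: if_splits)
  have "min s t < max s t" using that by auto
  then obtain z where z: "min s t < z" "z < max s t"
    "G (max s t) - G (min s t) = (max s t - min s t) * deriv G z"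
    using MVT2[of "min s t" "max s t" G "deriv G"] DERIV_G mem by blast
  have zI: "z \<in> I" using z mem by simp
  have "G s - G t = (s - t) * deriv G z"
    using z(3) by (auto simp: min_def max_def algebra_simps split: if_splits)
  then have "bregman G s t = (s - t) * (deriv G z - deriv G t)"
    by (simp add: bregman_def algebra_simps)
  moreover have "0 < (s - t) * (deriv G z - deriv G t)"
    using z deriv_G_less[OF zI \<open>t \<in> I\<close>] deriv_G_less[OF \<open>t \<in> I\<close> zI] that
    by (cases "s < t") (auto intro: mult_pos_pos mult_neg_neg)
  ultimately show ?thesis by simp
qed

lemma bregman_nonneg: "0 \<le> bregman G s t" if "s \<in> I" "t \<in> I"
  using bregman_pos[OF that] by (cases "s = t") (auto simp: bregman_def)

lemma bregman_eq_0_iff: "bregman G s t = 0 \<longleftrightarrow> s = t" if "s \<in> I" "t \<in> I"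
  using bregman_pos[OF that] by (cases "s = t") (auto simp: bregman_def)

section \<open>The convex conjugate and the inverse of G'\<close>

lemma conv_conj_deriv_G: "conv_conj G I (deriv G s) = deriv G s * s - G s" if "s \<in> I"
  unfolding conv_conj_def
proof (rule cSup_eq_maximum)
  fix y assume "y \<in> (\<lambda>t. deriv G s * t - G t) ` I"
  then obtain t where "t \<in> I" "y = deriv G s * t - G t" by blast
  \<comment> \<open>The gap between the two sides is exactly \<open>bregman G t s\<close>, so the
    supremum is attained at \<open>s\<close>.\<close>
  then show "y \<le> deriv G s * s - G s"
    using bregman_nonneg[of t s] that by (simp add: bregman_def algebra_simps)
qed (use that in blast)

text \<open>Openness makes the dual interval a Borel set and lets a formula valid on it be
  differentiated at each of its points.\<close>

lemma open_dual_interval: "open (dual_interval G I)"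
  unfolding dual_interval_def
  by (rule invariance_of_domain[OF continuous_on_deriv_G open_I inj_on_deriv_G])

lemma the_inv_into_deriv_G: "the_inv_into I (deriv G) (deriv G s) = s" if "s \<in> I"
  by (rule the_inv_into_f_f[OF inj_on_deriv_G that])

text \<open>Inverse function theorem: multiplication by \<open>deriv (deriv G) s\<close> is
  invertible because this number is positive.\<close>

lemma DERIV_inverse_deriv_G:
  "(the_inv_into I (deriv G) has_real_derivative inverse (deriv (deriv G) s)) (at (deriv G s))"
  if "s \<in> I"
  unfolding has_field_derivative_def
  by (rule has_derivative_inverse_strong[OF open_I that continuous_on_deriv_G the_inv_into_deriv_G
        DERIV_deriv_G[OF that, unfolded has_field_derivative_def]])
     (use deriv2_G_pos[OF that] in \<open>auto simp: fun_eq_iff\<close>)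

lemma continuous_on_inverse_deriv_G:
  "continuous_on (dual_interval G I) (the_inv_into I (deriv G))"
  unfolding dual_interval_def
  by (intro continuous_at_imp_continuous_on ballI)
     (auto intro: DERIV_isCont DERIV_inverse_deriv_G)

text \<open>With \<open>h\<close> the inverse of \<open>deriv G\<close>, the conjugate is
  \<open>u * h u - G (h u)\<close> on the dual interval. In its derivative the two terms containing
  the derivative of \<open>h\<close> cancel, because \<open>deriv G (h u) = u\<close>; what remains
  is \<open>h u\<close>.\<close>

lemma deriv_conv_conj: "deriv (conv_conj G I) (deriv G s) = s" if s: "s \<in> I"
proof (rule DERIV_imp_deriv)
  let ?h = "the_inv_into I (deriv G)"
  have "((\<lambda>u. u * ?h u - G (?h u)) has_real_derivative s) (at (deriv G s))"
  proof -
    have "(G has_real_derivative deriv G s) (at (?h (deriv G s)))"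
      using DERIV_G[OF s] the_inv_into_deriv_G[OF s] by simp
    from DERIV_diff[OF DERIV_mult[OF DERIV_ident DERIV_inverse_deriv_G[OF s]]
        DERIV_chain2[OF this DERIV_inverse_deriv_G[OF s]]]
    show ?thesis by (simp add: the_inv_into_deriv_G[OF s] mult.commute)
  qed
  then show "(conv_conj G I has_real_derivative s) (at (deriv G s))"
    by (rule has_field_derivative_transform_within_open[OF _ open_dual_interval])
       (use s in \<open>auto simp: dual_interval_def conv_conj_deriv_G the_inv_into_deriv_G\<close>)
qed

lemma deriv_conv_conj_mem: "deriv (conv_conj G I) u \<in> I"
  and deriv_G_deriv_conv_conj: "deriv G (deriv (conv_conj G I) u) = u"
  if "u \<in> dual_interval G I"
  using that by (auto simp: dual_interval_def deriv_conv_conj)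

section \<open>Measurability of the Bregman integrand and of \<open>p_star\<close>\<close>

lemma measurable_G [measurable]: "G \<in> borel_measurable (restrict_space borel I)"
  by (rule borel_measurable_continuous_on_restrict[OF continuous_on_G])

lemma measurable_deriv_G [measurable]: "deriv G \<in> borel_measurable (restrict_space borel I)"
  by (rule borel_measurable_continuous_on_restrict[OF continuous_on_deriv_G])

lemma measurable_bregman:
  assumes [measurable]: "p \<in> M \<rightarrow>\<^sub>M restrict_space borel I" "q \<in> M \<rightarrow>\<^sub>M restrict_space borel I"
  shows "(\<lambda>x. bregman G (p x) (q x)) \<in> borel_measurable M"
proof -
  have [measurable]: "p \<in> borel_measurable M" "q \<in> borel_measurable M"
    using assms by (auto simp: measurable_restrict_space2_iff)
  show ?thesis unfolding bregman_def by measurable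
qed

lemma measurable_into_mem: "p x \<in> I"
  if "p \<in> M \<rightarrow>\<^sub>M restrict_space borel I" "x \<in> space M"
  using measurable_space[OF that] by (simp add: space_restrict_space)

lemma measurable_p_star:
  assumes [measurable]: "p0 \<in> M \<rightarrow>\<^sub>M restrict_space borel I" "T \<in> borel_measurable M"
  shows "p_star G I T p0 l \<in> M \<rightarrow>\<^sub>M restrict_space borel I"
proof -
  have [measurable]: "p0 \<in> borel_measurable M"
    using assms by (auto simp: measurable_restrict_space2_iff)
  have [measurable]: "dual_interval G I \<in> sets borel" using open_dual_interval by simp
  have [measurable]: "dual_arg G T p0 l \<in> borel_measurable M"
    unfolding dual_arg_def[abs_def] by measurable
  \<comment> \<open>On the dual interval the derivative of the conjugate is the continuous inverse
    of \<open>deriv G\<close>. Extending this inverse by 0 gives a function that is Borel on the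
    whole line.\<close>
  let ?h = "\<lambda>u. if u \<in> dual_interval G I then the_inv_into I (deriv G) u else 0"
  have [measurable]: "?h \<in> borel_measurable borel"
    by (intro borel_measurable_continuous_on_if continuous_on_inverse_deriv_G) auto
  have "p_star G I T p0 l =
      (\<lambda>x. if dual_arg G T p0 l x \<in> dual_interval G I then ?h (dual_arg G T p0 l x) else p0 x)"
    by (rule ext) (auto simp: p_star_def dual_interval_def deriv_conv_conj the_inv_into_deriv_G)
  moreover have "\<dots> \<in> borel_measurable M" by measurable
  moreover have "p_star G I T p0 l x \<in> I" if "x \<in> space M" for x
    using that deriv_conv_conj_mem measurable_into_mem[OF assms(1)] by (simp add: p_star_def)
  ultimately show ?thesis by (auto simp: measurable_restrict_space2_iff)
qed

lemma deriv_G_p_star: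
  "deriv G (p_star G I T p0 l x) = dual_arg G T p0 l x"
  if "dual_arg G T p0 l x \<in> dual_interval G I"
  using that by (simp add: p_star_def deriv_G_deriv_conv_conj)

section \<open>Identities for the divergence and uniqueness of the parameter\<close>

lemma bregman_div_eq_0_iff:
  assumes p: "p \<in> M \<rightarrow>\<^sub>M restrict_space borel I" and q: "q \<in> M \<rightarrow>\<^sub>M restrict_space borel I"
  shows "bregman_div M G p q = 0 \<longleftrightarrow> (AE x in M. p x = q x)"
proof -
  have "bregman_div M G p q = 0 \<longleftrightarrow> (AE x in M. ennreal (bregman G (p x) (q x)) = 0)"
    unfolding bregman_div_def
    using measurable_bregman[OF p q] by (subst nn_integral_0_iff_AE) auto
  also have "\<dots> \<longleftrightarrow> (AE x in M. p x = q x)"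
  proof (rule AE_cong)
    fix x assume "x \<in> space M"
    then have "p x \<in> I" "q x \<in> I" using measurable_into_mem[OF p] measurable_into_mem[OF q] by simp_all
    \<comment> \<open>As \<open>ennreal\<close> sends negative reals to 0, the left side alone
      yields only \<open>bregman G (p x) (q x)\<close> at most 0; nonnegativity turns this into
      equality.\<close>
    then show "ennreal (bregman G (p x) (q x)) = 0 \<longleftrightarrow> p x = q x"
      using bregman_nonneg bregman_eq_0_iff by (simp add: ennreal_eq_0_iff order_antisym_conv)
  qed
  finally show ?thesis .
qed

lemma bregman_div_pythagoras:
  assumes p: "p \<in> M \<rightarrow>\<^sub>M restrict_space borel I" and q: "q \<in> M \<rightarrow>\<^sub>M restrict_space borel I"
    and r: "r \<in> M \<rightarrow>\<^sub>M restrict_space borel I"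
    and fin: "bregman_div M G p r < \<infinity>"
    and orth: "has_bochner_integral M (\<lambda>x. (p x - q x) * (deriv G (q x) - deriv G (r x))) 0"
  shows "bregman_div M G p r = bregman_div M G p q + bregman_div M G q r"
proof -
  let ?d = "\<lambda>p q x. bregman G (p x) (q x)"
  have nonneg: "AE x in M. 0 \<le> ?d u v x"
    if "u \<in> M \<rightarrow>\<^sub>M restrict_space borel I" "v \<in> M \<rightarrow>\<^sub>M restrict_space borel I" for u v
    using that by (intro AE_I2 bregman_nonneg measurable_into_mem)
  have three_point: "?d p q x + ?d q r x =
      ?d p r x - (p x - q x) * (deriv G (q x) - deriv G (r x))" for x
    by (simp add: bregman_def algebra_simps)
  have pr: "integrable M (?d p r)"
    using fin by (intro integrableI_nonneg measurable_bregman p r nonneg) (simp add: bregman_div_def)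
  \<comment> \<open>The two summands are not yet known to be integrable separately. Their sum is, by
    the three-point identity, and nonnegativity then allows splitting it as a
    \<open>nn_integral\<close>.\<close>
  have sum: "has_bochner_integral M (\<lambda>x. ?d p q x + ?d q r x) (integral\<^sup>L M (?d p r))"
    unfolding three_point
    using has_bochner_integral_diff[OF has_bochner_integral_integrable[OF pr] orth] by simp
  have "bregman_div M G p q + bregman_div M G q r
      = (\<integral>\<^sup>+x. ennreal (?d p q x) + ennreal (?d q r x) \<partial>M)"
    unfolding bregman_div_def
    using measurable_bregman[OF p q] measurable_bregman[OF q r]
    by (intro nn_integral_add[symmetric]) auto
  also have "\<dots> = (\<integral>\<^sup>+x. ennreal (?d p q x + ?d q r x) \<partial>M)"
    using nonneg[OF p q] nonneg[OF q r]
    by (intro nn_integral_cong_AE) auto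
  also have "\<dots> = ennreal (integral\<^sup>L M (\<lambda>x. ?d p q x + ?d q r x))"
    using nonneg[OF p q] nonneg[OF q r] sum
    by (intro nn_integral_eq_integral) (auto simp: has_bochner_integral_iff)
  also have "\<dots> = ennreal (integral\<^sup>L M (?d p r))"
    using sum by (simp add: has_bochner_integral_iff)
  also have "\<dots> = bregman_div M G p r"
    unfolding bregman_div_def using pr nonneg[OF p r] by (simp add: nn_integral_eq_integral)
  finally show ?thesis by simp
qed

text \<open>Source of the orthogonality used both in the Pythagorean identity and in the uniqueness
  of the parameter: equal moments cancel after pairing with \<open>l\<close>.\<close>

lemma has_bochner_integral_inner_moment_diff:
  fixes T :: "'a \<Rightarrow> 'b::euclidean_space"
  assumes "has_bochner_integral M (\<lambda>x. p x *\<^sub>R T x) c"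
    and "has_bochner_integral M (\<lambda>x. q x *\<^sub>R T x) c"
  shows "has_bochner_integral M (\<lambda>x. (p x - q x) * (l \<bullet> T x)) 0"
  using has_bochner_integral_inner_right[OF has_bochner_integral_diff[OF assms], of l]
  by (simp add: algebra_simps)

lemma p_star_parameter_unique:
  fixes T :: "'a \<Rightarrow> real^'k"
  assumes p0: "p0 \<in> M \<rightarrow>\<^sub>M restrict_space borel I"
    and T: "T \<in> borel_measurable M"
    and l: "AE x in M. dual_arg G T p0 l x \<in> dual_interval G I"
    and l': "AE x in M. dual_arg G T p0 l' x \<in> dual_interval G I"
    and c: "has_bochner_integral M (\<lambda>x. p_star G I T p0 l x *\<^sub>R T x) c"
    and c': "has_bochner_integral M (\<lambda>x. p_star G I T p0 l' x *\<^sub>R T x) c"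
  shows "l - l' \<in> null_directions M T"
proof -
  let ?p = "p_star G I T p0 l" and ?q = "p_star G I T p0 l'"
  let ?f = "\<lambda>x. (?p x - ?q x) * ((l - l') \<bullet> T x)"
  have int: "has_bochner_integral M ?f 0"
    by (rule has_bochner_integral_inner_moment_diff[OF c c'])
  have mem: "AE x in M. ?p x \<in> I \<and> ?q x \<in> I"
    by (intro AE_I2 conjI measurable_into_mem[OF measurable_p_star[OF p0 T]])
  \<comment> \<open>The common term \<open>deriv G (p0 x)\<close> cancels between the two dual
    arguments.\<close>
  have eq: "AE x in M. deriv G (?p x) - deriv G (?q x) = (l - l') \<bullet> T x"
    using l l' by eventually_elim (simp add: deriv_G_p_star dual_arg_def inner_diff_left)
  have "AE x in M. 0 \<le> ?f x"
    using eq mem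
  proof eventually_elim
    case (elim x)
    then show ?case
      using deriv_G_monotone_pos[of "?p x" "?q x"] by (cases "?p x = ?q x") auto
  qed
  then have "AE x in M. ?f x = 0"
    using int integral_nonneg_eq_0_iff_AE[of M ?f] by (auto simp: has_bochner_integral_iff)
  \<comment> \<open>By strict monotonicity a zero of \<open>?f\<close> forces
    \<open>?p x = ?q x\<close>, and then the left side of \<open>eq\<close> vanishes.\<close>
  with eq mem have "AE x in M. (l - l') \<bullet> T x = 0"
  proof eventually_elim
    case (elim x)
    then show ?case
      using deriv_G_monotone_pos[of "?p x" "?q x"] by (cases "?p x = ?q x") auto
  qed
  then show ?thesis by (simp add: null_directions_def)
qed

end

section \<open>First-order condition and the minimization theorem\<close>

lemma has_gradient_at_maximum_eq_0:
  fixes f :: "'b::euclidean_space \<Rightarrow> ereal"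
  assumes max: "\<And>m. f m \<le> f l" and D: "has_gradient_at f D l"
  shows "D = 0"
proof -
  have fin: "\<forall>\<^sub>F m in nhds l. \<bar>f m\<bar> \<noteq> \<infinity>"
    and der: "((\<lambda>m. real_of_ereal (f m)) has_derivative (\<lambda>h. h \<bullet> D)) (at l)"
    using D by (auto simp: has_gradient_at_def gderiv_def)
  obtain S where S: "open S" "l \<in> S" "\<And>m. m \<in> S \<Longrightarrow> \<bar>f m\<bar> \<noteq> \<infinity>"
    using fin by (auto simp: eventually_nhds)
  \<comment> \<open>Only near \<open>l\<close> does maximality pass to the real-valued version:
    elsewhere \<open>f m\<close> may be minus infinity, which \<open>real_of_ereal\<close> sends to
    0.\<close>
  have "real_of_ereal (f m) \<le> real_of_ereal (f l)" if "m \<in> S" for m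
    using max[of m] S(3)[OF that] S(3)[OF S(2)] by (cases "f m"; cases "f l") auto
  then have "(\<lambda>h. h \<bullet> D) = (\<lambda>h. 0)"
    using differential_zero_maxmin[OF S(2,1) der] by blast
  then show ?thesis by (metis inner_eq_zero_iff)
qed

theorem theorem1:
  fixes M :: "'a measure" and I :: "real set" and G :: "real \<Rightarrow> real"
    and T :: "'a \<Rightarrow> real^'k" and c :: "real^'k" and p0 :: "'a \<Rightarrow> real"
  assumes "sigma_finite_measure M"
    and "open I" and "is_interval I"
    and "T \<in> borel_measurable M"
    and "p0 \<in> M \<rightarrow>\<^sub>M restrict_space borel I"
    and A1: "G differentiable_on I" "deriv G differentiable_on I"
      "continuous_on I (deriv (deriv G))" "strict_convex_on I G"
      "\<forall>s\<in>I. deriv (deriv G) s > 0"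
    and A2: "feasible M G I T p0 c \<noteq> {}"
    and A3: "\<exists>l\<in>rel_interior (dual_domain M G I T p0).
        \<forall>m. dual_objective M G I T p0 c m \<le> dual_objective M G I T p0 c l"
      "0 \<in> dual_domain M G I T p0"
      "integrable M (\<lambda>x. conv_conj G I (deriv G (p0 x)))"
    and A4: "\<forall>l\<in>rel_interior (dual_domain M G I T p0).
        integrable M (\<lambda>x. p_star G I T p0 l x *\<^sub>R T x) \<and>
        has_gradient_at (dual_objective M G I T p0 c)
          (c - (LINT x|M. p_star G I T p0 l x *\<^sub>R T x)) l"
  shows "\<exists>p. is_arg_min (\<lambda>q. bregman_div M G q p0) (\<lambda>q. q \<in> feasible M G I T p0 c) p \<and>
      (\<forall>q. is_arg_min (\<lambda>q. bregman_div M G q p0) (\<lambda>q. q \<in> feasible M G I T p0 c) q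
         \<longrightarrow> (AE x in M. q x = p x)) \<and>
      (\<exists>l\<in>dual_domain M G I T p0.
         (AE x in M. p x = deriv (conv_conj G I) (deriv G (p0 x) + l \<bullet> T x)) \<and>
         has_bochner_integral M (\<lambda>x. p_star G I T p0 l x *\<^sub>R T x) c) \<and>
      (\<forall>l\<in>dual_domain M G I T p0. \<forall>l'\<in>dual_domain M G I T p0.
         has_bochner_integral M (\<lambda>x. p_star G I T p0 l x *\<^sub>R T x) c \<longrightarrow>
         has_bochner_integral M (\<lambda>x. p_star G I T p0 l' x *\<^sub>R T x) c \<longrightarrow>
         l - l' \<in> null_directions M T) \<and>
      p \<in> G_exp_family M G I T p0 \<and>
      (\<forall>q\<in>feasible M G I T p0 c.
         bregman_div M G q p0 = bregman_div M G q p + bregman_div M G p p0)"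
proof -
  interpret bregman_generator G I
    using \<open>open I\<close> \<open>is_interval I\<close> A1 by unfold_locales auto
  note p0 = \<open>p0 \<in> M \<rightarrow>\<^sub>M restrict_space borel I\<close> and T = \<open>T \<in> borel_measurable M\<close>
  obtain l where l_ri: "l \<in> rel_interior (dual_domain M G I T p0)"
    and max: "\<And>m. dual_objective M G I T p0 c m \<le> dual_objective M G I T p0 c l"
    using A3(1) by blast
  have l: "l \<in> dual_domain M G I T p0" using l_ri rel_interior_subset by blast
  then have arg: "AE x in M. dual_arg G T p0 l x \<in> dual_interval G I"
    by (simp add: dual_domain_def)
  let ?p = "p_star G I T p0 l"
  let ?F = "feasible M G I T p0 c" and ?D = "bregman_div M G"
  have p: "?p \<in> M \<rightarrow>\<^sub>M restrict_space borel I" by (rule measurable_p_star[OF p0 T])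
  \<comment> \<open>By (A4) this vector is the gradient of the dual objective at its maximizer
    \<open>l\<close>.\<close>
  have "c - (LINT x|M. ?p x *\<^sub>R T x) = 0"
    using A4 l_ri by (intro has_gradient_at_maximum_eq_0[where f = "dual_objective M G I T p0 c" and l = l] max) blast
  then have moment: "has_bochner_integral M (\<lambda>x. ?p x *\<^sub>R T x) c"
    using A4 l_ri by (auto simp: has_bochner_integral_iff)
  have pyth: "?D q p0 = ?D q ?p + ?D ?p p0" if "q \<in> ?F" for q
  proof -
    have q: "q \<in> M \<rightarrow>\<^sub>M restrict_space borel I" "has_bochner_integral M (\<lambda>x. q x *\<^sub>R T x) c"
      "?D q p0 < \<infinity>"
      using that by (auto simp: feasible_def)
    have [measurable]: "q \<in> borel_measurable M" "?p \<in> borel_measurable M"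
      using q(1) p by (auto simp: measurable_restrict_space2_iff)
    note [measurable] = p p0 T
    \<comment> \<open>The equality holds only almost everywhere: where the dual argument leaves the
      dual interval, \<open>?p\<close> falls back to \<open>p0\<close>.\<close>
    have "AE x in M. (q x - ?p x) * (l \<bullet> T x) = (q x - ?p x) * (deriv G (?p x) - deriv G (p0 x))"
      using arg by eventually_elim (simp add: deriv_G_p_star dual_arg_def)
    then have "has_bochner_integral M (\<lambda>x. (q x - ?p x) * (deriv G (?p x) - deriv G (p0 x))) 0"
      using has_bochner_integral_inner_moment_diff[OF q(2) moment, of l]
      by (subst has_bochner_integral_cong_AE[symmetric]) (auto, measurable)
    then show ?thesis by (rule bregman_div_pythagoras[OF q(1) p p0 q(3)])
  qed
  have minimal: "?D ?p p0 \<le> ?D q p0" if "q \<in> ?F" for q using pyth[OF that] by simp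
  \<comment> \<open>Feasibility of \<open>?p\<close> still lacks finite divergence from
    \<open>p0\<close>; comparison with any feasible point supplies it.\<close>
  obtain q0 where q0: "q0 \<in> ?F" using A2 by blast
  have "?D ?p p0 \<le> ?D q0 p0" by (rule minimal[OF q0])
  also have "\<dots> < \<infinity>" using q0 by (simp add: feasible_def)
  finally have fin: "?D ?p p0 < \<infinity>" .
  then have p_feasible: "?p \<in> ?F" using p moment by (simp add: feasible_def)
  have p_eq: "AE x in M. ?p x = deriv (conv_conj G I) (dual_arg G T p0 l x)"
    using arg by eventually_elim (simp add: p_star_def)
  show ?thesis
  proof (intro exI[of _ ?p] conjI allI ballI impI bexI[of _ l])
    show "is_arg_min (\<lambda>q. ?D q p0) (\<lambda>q. q \<in> ?F) ?p"
      using p_feasible minimal by (auto simp: is_arg_min_def not_less)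
  next
    fix q assume min: "is_arg_min (\<lambda>q. ?D q p0) (\<lambda>q. q \<in> ?F) q"
    then have q: "q \<in> ?F" and "?D q p0 \<le> ?D ?p p0"
      using p_feasible by (auto simp: is_arg_min_def not_less)
    then have "?D q ?p + ?D ?p p0 \<le> 0 + ?D ?p p0" using pyth[OF q] by simp
    \<comment> \<open>Cancelling \<open>?D ?p p0\<close> in \<open>ennreal\<close> is legitimate
      because it is finite.\<close>
    then have "?D q ?p = 0"
      using fin ennreal_add_left_cancel_le[of "?D ?p p0" "?D q ?p" 0] by (auto simp: add.commute)
    then show "AE x in M. q x = ?p x"
      using q p bregman_div_eq_0_iff by (auto simp: feasible_def)
  next
    show "AE x in M. ?p x = deriv (conv_conj G I) (deriv G (p0 x) + l \<bullet> T x)"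
      using p_eq by (simp add: dual_arg_def)
  next
    show "?p \<in> G_exp_family M G I T p0"
      using p arg p_eq by (auto simp: G_exp_family_def)
  next
    fix m m'
    assume "m \<in> dual_domain M G I T p0" "m' \<in> dual_domain M G I T p0"
      "has_bochner_integral M (\<lambda>x. p_star G I T p0 m x *\<^sub>R T x) c"
      "has_bochner_integral M (\<lambda>x. p_star G I T p0 m' x *\<^sub>R T x) c"
    then show "m - m' \<in> null_directions M T"
      by (intro p_star_parameter_unique[OF p0 T]) (auto simp: dual_domain_def)
  qed (fact l moment pyth)+
qed

end
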